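(* $\mathbf{KF}$ has exactly $70$ local collapses.
   Context: $(X,\mathcal T)$ denotes a nonempty topological space. Set operators are maps $2^X\to 2^X$; products are compositions, $(o_1o_2)A=o_1(o_2A)$. Let $a$ be complement, $b$ closure, $i=aba$ interior, $f$ boundary ($fA=bA\cap b(aA)$), $\mathrm{id}$ the identity operator, $0A=\varnothing$. Put $\mathbf K^0=\{\mathrm{id},b,i,bi,ib,bib,ibi\}$, $\mathbf F^0=\{0,f,if,fif,bif,ff,fb,fi,fbi,fib\}$, $\mathbf{KF}^0=\mathbf K^0\cup\mathbf F^0$, $\mathbf{KF}=\mathbf{KF}^0\cup a\mathbf{KF}^0$, regarded as a set of 34 formal words, each interpreted as an operator in every space. A collapse of $\mathbf{KF}$ is a set of unordered pairs of words in $\mathbf{KF}$. A subset $A$ of a space satisfies a collapse $C$ if for all (distinct) words $o_1,o_2\in\mathbf{KF}$: $o_1A=o_2A$ if and only if $\{o_1,o_2\}\in C$. A local collapse is one satisfied by some subset of some nonempty topological space. *)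

theory Defs
  imports "HOL-Analysis.Abstract_Topology"
begin

text \<open>
  Words are kept as syntactic objects, independent of any space, so that one and the same
  collapse can be compared across spaces. A word is a list of letters; the empty list is
  the identity, and juxtaposition is composition, so the rightmost letter acts first.
\<close>

datatype letter = Compl | Clo | Itr | Bd | Zero

type_synonym word = "letter list"

fun letter_op :: "'a topology \<Rightarrow> letter \<Rightarrow> 'a set \<Rightarrow> 'a set" where
  "letter_op X Compl A = topspace X - A"
| "letter_op X Clo A = X closure_of A"
| "letter_op X Itr A = X interior_of A"
| "letter_op X Bd A = X frontier_of A"
| "letter_op X Zero A = {}"

definition word_op :: "'a topology \<Rightarrow> word \<Rightarrow> 'a set \<Rightarrow> 'a set" where
  "word_op X w A = foldr (letter_op X) w A"

lemma letter_op_Itr: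
  "letter_op X Itr A = letter_op X Compl (letter_op X Clo (letter_op X Compl A))"
  by (simp add: interior_of_closure_of)

lemma letter_op_Bd:
  "letter_op X Bd A = letter_op X Clo A \<inter> letter_op X Clo (letter_op X Compl A)"
  by (simp add: frontier_of_closures)

definition K0 :: "word set" where
  "K0 = {[], [Clo], [Itr], [Clo, Itr], [Itr, Clo], [Clo, Itr, Clo], [Itr, Clo, Itr]}"

definition F0 :: "word set" where
  "F0 = {[Zero], [Bd], [Itr, Bd], [Bd, Itr, Bd], [Clo, Itr, Bd], [Bd, Bd],
         [Bd, Clo], [Bd, Itr], [Bd, Clo, Itr], [Bd, Itr, Clo]}"

definition KF0 :: "word set" where
  "KF0 = K0 \<union> F0"

definition KF :: "word set" where
  "KF = KF0 \<union> Cons Compl ` KF0"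

lemma card_KF: "card KF = 34"
  by (simp add: KF_def KF0_def K0_def F0_def)

text \<open>
  An unordered pair is a two-element set; the trivial pairs of a word with itself are not
  part of a collapse.
\<close>

definition collapse :: "word set set \<Rightarrow> bool" where
  "collapse C \<longleftrightarrow> C \<subseteq> {{u, v} | u v. u \<in> KF \<and> v \<in> KF \<and> u \<noteq> v}"

definition satisfies :: "'a topology \<Rightarrow> 'a set \<Rightarrow> word set set \<Rightarrow> bool" where
  "satisfies X A C \<longleftrightarrow>
     (\<forall>u\<in>KF. \<forall>v\<in>KF. u \<noteq> v \<longrightarrow> (word_op X u A = word_op X v A \<longleftrightarrow> {u, v} \<in> C))"

text \<open>
  The local collapses witnessed by spaces whose points are drawn from the type \<open>'a\<close>.
  HOL cannot quantify over types inside a formula, so the collection of all local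
  collapses is the union of these sets over all types.
\<close>

definition local_collapses :: "'a itself \<Rightarrow> word set set set" where
  "local_collapses _ =
     {C. collapse C \<and>
         (\<exists>(X :: 'a topology) A. topspace X \<noteq> {} \<and> A \<subseteq> topspace X \<and> satisfies X A C)}"

end

theory Submission
  imports Defs
begin

text \<open>
  Let \<open>I\<close> be the interior of a subset \<open>A\<close> of a space, \<open>E\<close> the interior of its complement and \<open>D\<close> the
  interior of its frontier. These open sets are disjoint and their union is dense. The interior
  of the closure of one of them is therefore the complement of the closures of the other two, so
  that all words give Boolean combinations of \<open>A\<close>, \<open>I\<close>, \<open>E\<close> and the closures of \<open>I\<close>, \<open>E\<close>, \<open>D\<close>
  (\<open>word_op_kind_at\<close>). Relative to these sets there are only 16 kinds of points, and the collapse
  satisfied by \<open>A\<close> is a function of the set of kinds that occur (\<open>satisfies_iff\<close>).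

  Some kinds force others to occur nearby, for instance a point in the closure of \<open>I\<close> forces an
  interior point. The sets of kinds that occur are closed under this relation
  (\<open>up_closed_kinds\<close>). Conversely, the relation defines a topology with 16 points, one of each kind,
  and its open subspaces realise every nonempty closed set of kinds (\<open>realisation\<close>). So the local
  collapses are the collapses of the nonempty closed sets of kinds; since the realising spaces are
  finite, they are already found on the natural numbers.

  It remains to count. On closed sets of kinds every equation between words is equivalent to a
  conjunction of some of 16 basic equations (\<open>separates_basic\<close>), so a collapse amounts to the set of
  basic equations that fail, its signature (\<open>collapse_of_eq_iff\<close>). The signature of a set of kinds
  is the union of the signatures of its members, and there are 71 such unions, one of them empty
  and belonging to the empty space (\<open>count_signatures\<close>).
\<close>

section \<open>Kinds of points\<close>

text \<open>
  The closures of the three pieces interior, exterior and dust of a subset cover the space, so a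
  point is described by the nonempty set of pieces adherent to it and by whether it lies in
  the subset, which is the Boolean argument. If only the interior adheres, the point is an
  interior point (\<open>Inn\<close>) or has been cut out of, or left over inside, a regular open set
  (\<open>Slit\<close>); dually \<open>Out\<close> and \<open>Whisker\<close> for the exterior. If only the dust adheres, the point
  belongs to the dust. The other constructors are the four ways of meeting several pieces.
  Complementing the subset exchanges \<open>Inn\<close> with \<open>Out\<close>, \<open>Slit\<close> with \<open>Whisker\<close> and
  \<open>Dust_Inn\<close> with \<open>Dust_Out\<close>.
\<close>

datatype kind = Inn | Out | Slit bool | Whisker bool | Dust bool
  | Wall bool | Dust_Inn bool | Dust_Out bool | Triple bool

text \<open>
  The kinds that are forced to occur in every neighbourhood of a point of the given kind. A
  \<open>Slit\<close> point of the subset is not interior, so a point outside the subset lies near it, while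
  a \<open>Slit\<close> point outside the subset needs only interior points; \<open>Dust\<close> points come in both
  colours because the dust is open and contained in the frontier. Read as minimal neighbourhoods,
  these lists make the kinds themselves into a topological space of 16 points.
\<close>

fun up :: "kind \<Rightarrow> kind list" where
  "up Inn = [Inn]"
| "up Out = [Out]"
| "up (Slit j) = (if j then [Slit True, Slit False, Inn] else [Slit False, Inn])"
| "up (Whisker j) = (if j then [Whisker True, Out] else [Whisker False, Whisker True, Out])"
| "up (Dust j) = [Dust True, Dust False]"
| "up (Wall j) = [Wall j, Inn, Out]"
| "up (Dust_Inn j) = [Dust_Inn j, Inn, Dust True, Dust False]"
| "up (Dust_Out j) = [Dust_Out j, Out, Dust True, Dust False]"
| "up (Triple j) = [Triple j, Inn, Out, Dust True, Dust False]"

fun in_set :: "kind \<Rightarrow> bool" where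
  "in_set Inn = True"
| "in_set Out = False"
| "in_set (Slit j) = j"
| "in_set (Whisker j) = j"
| "in_set (Dust j) = j"
| "in_set (Wall j) = j"
| "in_set (Dust_Inn j) = j"
| "in_set (Dust_Out j) = j"
| "in_set (Triple j) = j"

definition kinds :: "kind list" where
  "kinds = [Inn, Out] @ concat [[c True, c False].
     c \<leftarrow> [Slit, Whisker, Dust, Wall, Dust_Inn, Dust_Out, Triple]]"

text \<open>
  In every list \<open>up t\<close> the two kinds of dust occur together, so either of them tells whether dust
  is near.
\<close>

abbreviation "near_inn t \<equiv> Inn \<in> set (up t)"
abbreviation "near_out t \<equiv> Out \<in> set (up t)"
abbreviation "near_dust t \<equiv> Dust True \<in> set (up t)"

text \<open>
  The kinds of the points that each word collects. The entries are obtained by writing the word as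
  a Boolean combination of the subset, its interior, its exterior and the closures of the three
  pieces, the dust being the complement of the other two closures.
\<close>

definition region_table :: "(word \<times> (kind \<Rightarrow> bool)) list" where
  "region_table =
    [([],              in_set),
     ([Clo],           \<lambda>t. t \<noteq> Out),
     ([Itr],           \<lambda>t. t = Inn),
     ([Clo, Itr],      \<lambda>t. near_inn t),
     ([Itr, Clo],      \<lambda>t. \<not> near_out t),
     ([Clo, Itr, Clo], \<lambda>t. near_inn t \<or> near_dust t),
     ([Itr, Clo, Itr], \<lambda>t. \<not> near_out t \<and> \<not> near_dust t),
     ([Zero],          \<lambda>t. False),
     ([Bd],            \<lambda>t. t \<noteq> Inn \<and> t \<noteq> Out),
     ([Itr, Bd],       \<lambda>t. \<not> near_inn t \<and> \<not> near_out t),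
     ([Bd, Itr, Bd],   \<lambda>t. near_dust t \<and> (near_inn t \<or> near_out t)),
     ([Clo, Itr, Bd],  \<lambda>t. near_dust t),
     ([Bd, Bd],        \<lambda>t. t \<noteq> Inn \<and> t \<noteq> Out \<and> (near_inn t \<or> near_out t)),
     ([Bd, Clo],       \<lambda>t. near_out t \<and> t \<noteq> Out),
     ([Bd, Itr],       \<lambda>t. near_inn t \<and> t \<noteq> Inn),
     ([Bd, Clo, Itr],  \<lambda>t. near_inn t \<and> (near_out t \<or> near_dust t)),
     ([Bd, Itr, Clo],  \<lambda>t. near_out t \<and> (near_inn t \<or> near_dust t))]"

fun region :: "word \<Rightarrow> kind \<Rightarrow> bool" where
  "region (Compl # w) t = (\<not> region w t)"
| "region w t = the (map_of region_table w) t"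

lemma region_eq: "(w, p) \<in> set region_table \<Longrightarrow> region w = p"
  by (simp add: region_table_def, elim disjE) (auto simp: region_table_def)

lemma KF0_eq: "KF0 = fst ` set region_table"
  by (auto simp: KF0_def K0_def F0_def region_table_def)

section \<open>Points of a space relative to a subset\<close>

text \<open>
  The pieces are the interior of the subset, its exterior and the interior of its frontier; on the
  last one the subset and its complement are both dense, hence the name dust. Since the frontier
  of \<open>A\<close> is closed, its points outside the dust form a nowhere dense set, which is why these three
  disjoint open sets are together dense.
\<close>

locale subset_in_space =
  fixes X :: "'a topology" and A :: "'a set"
  assumes A_sub: "A \<subseteq> topspace X"
begin

definition inn :: "'a set" where "inn = X interior_of A"
definition out :: "'a set" where "out = X interior_of (topspace X - A)"
definition dust :: "'a set" where "dust = X interior_of (X frontier_of A)"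

abbreviation (input) cl :: "'a set \<Rightarrow> 'a set" where "cl S \<equiv> X closure_of S"
abbreviation (input) intr :: "'a set \<Rightarrow> 'a set" where "intr S \<equiv> X interior_of S"

lemma open_pieces: "openin X inn" "openin X out" "openin X dust"
  by (simp_all add: inn_def out_def dust_def)

lemma pieces_subset: "inn \<subseteq> A" "out \<subseteq> topspace X - A" "dust \<subseteq> X frontier_of A"
  by (simp_all add: inn_def out_def dust_def interior_of_subset)

lemma closure_eq: "cl A = topspace X - out"
  using closure_of_subset_topspace[of X A] by (auto simp: out_def interior_of_complement)

lemma frontier_eq: "X frontier_of A = topspace X - inn - out"
  by (auto simp: frontier_of_def closure_eq inn_def)

lemma pieces_disjoint: "inn \<inter> out = {}" "inn \<inter> dust = {}" "out \<inter> dust = {}"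
  using pieces_subset frontier_eq by auto

lemma pieces_subset_closure: "inn \<subseteq> cl inn" "out \<subseteq> cl out" "dust \<subseteq> cl dust"
  using open_pieces by (simp_all add: closure_of_subset openin_subset)

lemma pieces_closure_disjoint:
  "inn \<inter> cl out = {}" "inn \<inter> cl dust = {}" "out \<inter> cl inn = {}" "out \<inter> cl dust = {}"
  "dust \<inter> cl inn = {}" "dust \<inter> cl out = {}"
  using open_pieces pieces_disjoint by (simp_all add: openin_Int_closure_of_eq_empty Int_commute)

lemma dust_eq: "dust = topspace X - (cl inn \<union> cl out)"
proof
  show "dust \<subseteq> topspace X - (cl inn \<union> cl out)"
    using pieces_closure_disjoint(5,6) openin_subset[OF open_pieces(3)] by blast
  show "topspace X - (cl inn \<union> cl out) \<subseteq> dust"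
    unfolding dust_def
  proof (rule interior_of_maximal)
    show "topspace X - (cl inn \<union> cl out) \<subseteq> X frontier_of A"
      using pieces_subset_closure(1,2) unfolding frontier_eq by blast
    show "openin X (topspace X - (cl inn \<union> cl out))"
      by (simp add: openin_diff closedin_Un)
  qed
qed

lemma pieces_dense: "cl inn \<union> cl out \<union> cl dust = topspace X"
  using dust_eq pieces_subset_closure(3) closure_of_subset_topspace[of X inn]
    closure_of_subset_topspace[of X out] closure_of_subset_topspace[of X dust] by blast

end

text \<open>
  An open set inside the closure of \<open>U\<close> cannot meet the disjoint open sets \<open>V\<close> and \<open>W\<close>, so it
  misses their closures too; conversely the complement of these closures is open, and by density
  it lies in the closure of \<open>U\<close>. This is what stops the operators from producing new sets.
\<close>

lemma interior_closure_of_piece: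
  assumes "openin X V" "openin X W" "U \<inter> V = {}" "U \<inter> W = {}"
    and dense: "X closure_of U \<union> X closure_of V \<union> X closure_of W = topspace X"
  shows "X interior_of (X closure_of U) = topspace X - (X closure_of V \<union> X closure_of W)"
proof
  have avoid: "X interior_of (X closure_of U) \<inter> X closure_of S = {}" if "openin X S" "U \<inter> S = {}" for S
  proof -
    have "S \<inter> X closure_of U = {}"
      using that by (simp add: openin_Int_closure_of_eq_empty Int_commute)
    hence "X interior_of (X closure_of U) \<inter> S = {}"
      using interior_of_subset[of X "X closure_of U"] by blast
    thus ?thesis by (simp add: openin_Int_closure_of_eq_empty)
  qed
  show "X interior_of (X closure_of U) \<subseteq> topspace X - (X closure_of V \<union> X closure_of W)"
    using avoid[of V] avoid[of W] assms(1-4) interior_of_subset_topspace[of X "X closure_of U"] by auto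
  show "topspace X - (X closure_of V \<union> X closure_of W) \<subseteq> X interior_of (X closure_of U)"
  proof (rule interior_of_maximal)
    show "topspace X - (X closure_of V \<union> X closure_of W) \<subseteq> X closure_of U"
      using dense by blast
    show "openin X (topspace X - (X closure_of V \<union> X closure_of W))"
      by (simp add: openin_diff closedin_Un)
  qed
qed

context subset_in_space
begin

lemma interior_closures:
  "intr (cl inn) = topspace X - (cl out \<union> cl dust)"
  "intr (cl out) = topspace X - (cl inn \<union> cl dust)"
  "intr (cl dust) = topspace X - (cl inn \<union> cl out)"
proof -
  have dense: "cl inn \<union> cl out \<union> cl dust = topspace X" "cl out \<union> cl inn \<union> cl dust = topspace X"
    "cl dust \<union> cl inn \<union> cl out = topspace X"
    using pieces_dense by auto
  have disj: "out \<inter> inn = {}" "dust \<inter> inn = {}" "dust \<inter> out = {}"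
    using pieces_disjoint by auto
  show "intr (cl inn) = topspace X - (cl out \<union> cl dust)"
    by (rule interior_closure_of_piece[OF open_pieces(2,3) pieces_disjoint(1,2) dense(1)])
  show "intr (cl out) = topspace X - (cl inn \<union> cl dust)"
    by (rule interior_closure_of_piece[OF open_pieces(1,3) disj(1) pieces_disjoint(3) dense(2)])
  show "intr (cl dust) = topspace X - (cl inn \<union> cl out)"
    by (rule interior_closure_of_piece[OF open_pieces(1,2) disj(2,3) dense(3)])
qed

lemma frontier_of_open: "openin X S \<Longrightarrow> X frontier_of S = cl S - S"
  by (simp add: frontier_of_def interior_of_openin)

lemma interior_compl_piece: "intr (topspace X - S) = topspace X - cl S"
  by (simp add: interior_of_complement)

lemma closure_compl_closure: "cl (topspace X - S) = topspace X - intr S"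
  by (simp add: closure_of_complement)

lemma word_sets:
  "word_op X [] A = A"
  "word_op X [Clo] A = topspace X - out"
  "word_op X [Itr] A = inn"
  "word_op X [Clo, Itr] A = cl inn"
  "word_op X [Itr, Clo] A = topspace X - cl out"
  "word_op X [Clo, Itr, Clo] A = cl inn \<union> cl dust"
  "word_op X [Itr, Clo, Itr] A = topspace X - (cl out \<union> cl dust)"
  "word_op X [Zero] A = {}"
  "word_op X [Bd] A = topspace X - inn - out"
  "word_op X [Itr, Bd] A = dust"
  "word_op X [Bd, Itr, Bd] A = cl dust - dust"
  "word_op X [Clo, Itr, Bd] A = cl dust"
  "word_op X [Bd, Bd] A = topspace X - inn - out - dust"
  "word_op X [Bd, Clo] A = cl out - out"
  "word_op X [Bd, Itr] A = cl inn - inn"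
  "word_op X [Bd, Clo, Itr] A = cl inn \<inter> (cl out \<union> cl dust)"
  "word_op X [Bd, Itr, Clo] A = cl out \<inter> (cl inn \<union> cl dust)"
proof -
  have b: "cl A = topspace X - out" by (rule closure_eq)
  have i: "intr A = inn" by (simp add: inn_def)
  have f: "X frontier_of A = topspace X - inn - out" by (rule frontier_eq)
  have ib: "intr (topspace X - out) = topspace X - cl out" by (rule interior_compl_piece)
  have sub: "cl inn \<subseteq> topspace X" "cl out \<subseteq> topspace X" "cl dust \<subseteq> topspace X"
    by (simp_all add: closure_of_subset_topspace)
  have bib: "cl (topspace X - cl out) = cl inn \<union> cl dust"
    using sub by (auto simp: closure_compl_closure interior_closures)
  have closed_f: "cl (topspace X - inn - out) = topspace X - inn - out"
    by (metis closure_of_eq closedin_frontier_of frontier_eq)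
  have d: "intr (topspace X - inn - out) = dust" by (simp add: dust_def frontier_eq)
  show
    "word_op X [] A = A"
    "word_op X [Clo] A = topspace X - out"
    "word_op X [Itr] A = inn"
    "word_op X [Clo, Itr] A = cl inn"
    "word_op X [Itr, Clo] A = topspace X - cl out"
    "word_op X [Clo, Itr, Clo] A = cl inn \<union> cl dust"
    "word_op X [Itr, Clo, Itr] A = topspace X - (cl out \<union> cl dust)"
    "word_op X [Zero] A = {}"
    "word_op X [Bd] A = topspace X - inn - out"
    "word_op X [Itr, Bd] A = dust"
    "word_op X [Bd, Itr, Bd] A = cl dust - dust"
    "word_op X [Clo, Itr, Bd] A = cl dust"
    by (simp_all add: word_op_def b i f ib bib d interior_closures frontier_of_open open_pieces)
  show "word_op X [Bd, Bd] A = topspace X - inn - out - dust"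
    by (simp add: word_op_def f) (simp add: frontier_of_def closed_f d)
  show "word_op X [Bd, Clo] A = cl out - out"
    using sub by (auto simp: word_op_def b frontier_of_complement frontier_of_open open_pieces)
  show "word_op X [Bd, Itr] A = cl inn - inn"
    by (simp add: word_op_def i frontier_of_open open_pieces)
  show "word_op X [Bd, Clo, Itr] A = cl inn \<inter> (cl out \<union> cl dust)"
    using sub by (auto simp: word_op_def i frontier_of_def interior_closures)
  show "word_op X [Bd, Itr, Clo] A = cl out \<inter> (cl inn \<union> cl dust)"
    using sub by (auto simp: word_op_def b ib frontier_of_complement)
      (auto simp: frontier_of_def interior_closures)
qed

text \<open>
  Inside the space some closure contains the point, so the last case stands for all three of them.
\<close>

definition kind_at :: "'a \<Rightarrow> kind" where
  "kind_at x =
    (if x \<in> inn then Inn else if x \<in> out then Out else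
     (case (x \<in> cl inn, x \<in> cl out, x \<in> cl dust) of
        (True, False, False) \<Rightarrow> Slit
      | (False, True, False) \<Rightarrow> Whisker
      | (False, False, True) \<Rightarrow> Dust
      | (True, True, False) \<Rightarrow> Wall
      | (True, False, True) \<Rightarrow> Dust_Inn
      | (False, True, True) \<Rightarrow> Dust_Out
      | _ \<Rightarrow> Triple) (x \<in> A))"

lemma kind_at_simps:
  assumes "x \<in> topspace X"
  shows "kind_at x = Inn \<longleftrightarrow> x \<in> inn"
    and "kind_at x = Out \<longleftrightarrow> x \<in> out"
    and "near_inn (kind_at x) \<longleftrightarrow> x \<in> cl inn"
    and "near_out (kind_at x) \<longleftrightarrow> x \<in> cl out"
    and "near_dust (kind_at x) \<longleftrightarrow> x \<in> cl dust"
    and "in_set (kind_at x) \<longleftrightarrow> x \<in> A"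
proof -
  consider "x \<in> inn" "x \<in> cl inn" "x \<notin> out" "x \<notin> cl out" "x \<notin> cl dust" "x \<in> A"
    | "x \<in> out" "x \<notin> inn" "x \<notin> cl inn" "x \<in> cl out" "x \<notin> cl dust" "x \<notin> A"
    | "x \<notin> inn" "x \<notin> out" "x \<in> cl inn \<or> x \<in> cl out \<or> x \<in> cl dust"
  proof -
    have "x \<notin> cl out" "x \<notin> cl dust" "x \<notin> out" "x \<in> A" "x \<in> cl inn" if "x \<in> inn"
      using that pieces_closure_disjoint(1,2) pieces_disjoint(1) pieces_subset(1)
        pieces_subset_closure(1) by auto
    moreover have "x \<notin> cl inn" "x \<notin> cl dust" "x \<notin> inn" "x \<notin> A" "x \<in> cl out" if "x \<in> out"
      using that pieces_closure_disjoint(3,4) pieces_disjoint(1) pieces_subset(2)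
        pieces_subset_closure(2) by auto
    moreover have "x \<in> cl inn \<or> x \<in> cl out \<or> x \<in> cl dust"
      using pieces_dense assms by auto
    ultimately show ?thesis using that by metis
  qed
  note split = this
  have "(kind_at x = Inn \<longleftrightarrow> x \<in> inn) \<and> (kind_at x = Out \<longleftrightarrow> x \<in> out) \<and>
    (near_inn (kind_at x) \<longleftrightarrow> x \<in> cl inn) \<and> (near_out (kind_at x) \<longleftrightarrow> x \<in> cl out) \<and>
    (near_dust (kind_at x) \<longleftrightarrow> x \<in> cl dust) \<and> (in_set (kind_at x) \<longleftrightarrow> x \<in> A)"
    by (cases rule: split; cases "x \<in> cl inn"; cases "x \<in> cl out"; cases "x \<in> cl dust")
      (simp_all add: kind_at_def)
  thus "kind_at x = Inn \<longleftrightarrow> x \<in> inn"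
    and "kind_at x = Out \<longleftrightarrow> x \<in> out"
    and "near_inn (kind_at x) \<longleftrightarrow> x \<in> cl inn"
    and "near_out (kind_at x) \<longleftrightarrow> x \<in> cl out"
    and "near_dust (kind_at x) \<longleftrightarrow> x \<in> cl dust"
    and "in_set (kind_at x) \<longleftrightarrow> x \<in> A"
    by blast+
qed

lemma word_op_region_table:
  assumes "(w, p) \<in> set region_table"
  shows "word_op X w A = {x \<in> topspace X. p (kind_at x)}"
proof -
  have sub: "inn \<subseteq> topspace X" "out \<subseteq> topspace X" "dust \<subseteq> topspace X"
    "cl inn \<subseteq> topspace X" "cl out \<subseteq> topspace X" "cl dust \<subseteq> topspace X"
    using open_pieces by (simp_all add: closure_of_subset_topspace openin_subset)
  have d: "x \<in> dust \<longleftrightarrow> x \<in> topspace X \<and> x \<notin> cl inn \<and> x \<notin> cl out" for x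
    by (subst dust_eq) blast
  have K: "{x \<in> topspace X. p (kind_at x)} = word_op X w A"
    using assms A_sub sub unfolding region_table_def
    by (simp only: list.set insert_iff empty_iff prod.inject simp_thms, elim disjE conjE;
      simp only: word_sets kind_at_simps set_eq_iff mem_Collect_eq cong: conj_cong)
     (blast dest: d[THEN iffD1] intro: d[THEN iffD2])+
  thus ?thesis by simp
qed

lemma word_op_kind_at:
  assumes "w \<in> KF"
  shows "word_op X w A = {x \<in> topspace X. region w (kind_at x)}"
proof (cases "w \<in> KF0")
  case True
  thus ?thesis using word_op_region_table region_eq by (fastforce simp: KF0_eq)
next
  case False
  then obtain v where v: "w = Compl # v" "v \<in> KF0" using assms by (auto simp: KF_def)
  hence "word_op X v A = {x \<in> topspace X. region v (kind_at x)}"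
    using word_op_region_table region_eq by (fastforce simp: KF0_eq)
  thus ?thesis by (auto simp: v(1) word_op_def)
qed

text \<open>
  Each further kind in \<open>up t\<close> is found in a nonempty open set. An adherent piece is nonempty and
  consists of points of its own kind; the dust shows both colours, for a nonempty open subset of
  the frontier is contained neither in the subset nor in its complement. For slits and whiskers
  the open set is the complement of the other two closures, which cannot be contained in the
  subset (or in its complement), for then the point would belong to the interior (or to the
  exterior).
\<close>

lemma up_closed_kinds:
  assumes "t \<in> kind_at ` topspace X"
  shows "set (up t) \<subseteq> kind_at ` topspace X"
proof -
  obtain x where x: "x \<in> topspace X" and t: "t = kind_at x" using assms by blast
  let ?R = "kind_at ` topspace X"
  have attained: "kind_at y \<in> ?R" if "y \<in> topspace X" for y using that by blast
  have inn: "Inn \<in> ?R" if "near_inn t"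
  proof -
    have "inn \<noteq> {}" using that x by (auto simp: t kind_at_simps)
    then obtain y where y: "y \<in> inn" "y \<in> topspace X"
      using openin_subset[OF open_pieces(1)] by blast
    hence "kind_at y = Inn" using kind_at_simps(1) by blast
    thus ?thesis using attained[OF y(2)] by metis
  qed
  have out: "Out \<in> ?R" if "near_out t"
  proof -
    have "out \<noteq> {}" using that x by (auto simp: t kind_at_simps)
    then obtain y where y: "y \<in> out" "y \<in> topspace X"
      using openin_subset[OF open_pieces(2)] by blast
    hence "kind_at y = Out" using kind_at_simps(2) by blast
    thus ?thesis using attained[OF y(2)] by metis
  qed
  have dust: "Dust j \<in> ?R" if "near_dust t" for j
  proof -
    have ne: "dust \<noteq> {}" using that x by (auto simp: t kind_at_simps)
    have "dust \<subseteq> topspace X" using open_pieces(3) by (rule openin_subset)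
    have "\<not> dust \<subseteq> A"
      using ne pieces_disjoint(2) interior_of_maximal[OF _ open_pieces(3), of A]
      by (auto simp: inn_def)
    moreover have "\<not> dust \<subseteq> topspace X - A"
      using ne pieces_disjoint(3) interior_of_maximal[OF _ open_pieces(3), of "topspace X - A"]
      by (auto simp: out_def)
    ultimately obtain y where y: "y \<in> dust" "y \<in> A \<longleftrightarrow> j"
      using \<open>dust \<subseteq> topspace X\<close> by (cases j) blast+
    hence "y \<notin> inn" "y \<notin> out" "y \<in> cl dust" "y \<notin> cl inn" "y \<notin> cl out"
      using pieces_disjoint(2,3) pieces_closure_disjoint(5,6) pieces_subset_closure(3) by auto
    with y have "kind_at y = Dust j" by (simp add: kind_at_def)
    thus ?thesis using attained[of y] y \<open>dust \<subseteq> topspace X\<close> by (metis subsetD)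
  qed
  have slit: "Slit False \<in> ?R" if "t = Slit True"
  proof -
    let ?G = "topspace X - (cl out \<union> cl dust)"
    have "x \<in> ?G" "x \<notin> inn" using that x kind_at_simps[OF x] by (auto simp: t)
    moreover have "openin X ?G" by (simp add: openin_diff closedin_Un)
    ultimately have "\<not> ?G \<subseteq> A"
      using interior_of_maximal[of ?G A X] by (auto simp: inn_def)
    then obtain y where y: "y \<in> ?G" "y \<notin> A" by blast
    hence "y \<notin> inn" "y \<notin> out" "y \<in> cl inn"
      using pieces_subset(1) pieces_subset_closure(2) pieces_dense by auto
    with y have "kind_at y = Slit False" by (simp add: kind_at_def)
    thus ?thesis using attained[of y] y by (metis DiffD1)
  qed
  have whisker: "Whisker True \<in> ?R" if "t = Whisker False"
  proof -
    let ?G = "topspace X - (cl inn \<union> cl dust)"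
    have "x \<in> ?G" "x \<notin> out" using that x kind_at_simps[OF x] by (auto simp: t)
    moreover have "openin X ?G" by (simp add: openin_diff closedin_Un)
    ultimately have "\<not> ?G \<subseteq> topspace X - A"
      using interior_of_maximal[of ?G "topspace X - A" X] by (auto simp: out_def)
    then obtain y where y: "y \<in> ?G" "y \<in> A" by blast
    hence "y \<notin> inn" "y \<notin> out" "y \<in> cl out"
      using pieces_subset(2) pieces_subset_closure(1) pieces_dense by auto
    with y have "kind_at y = Whisker True" by (simp add: kind_at_def)
    thus ?thesis using attained[of y] y by (metis DiffD1)
  qed
  show ?thesis
    using inn out dust slit whisker assms by (cases t) (auto split: if_splits)
qed

end

section \<open>Every nonempty up-closed set of kinds occurs\<close>

text \<open>
  The topology in which every point has a smallest neighbourhood, prescribed by \<open>N\<close>.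
\<close>

locale minimal_neighbourhoods =
  fixes S :: "'b set" and N :: "'b \<Rightarrow> 'b set"
  assumes N_refl: "x \<in> S \<Longrightarrow> x \<in> N x"
    and N_trans: "x \<in> S \<Longrightarrow> y \<in> N x \<Longrightarrow> N y \<subseteq> N x"
    and N_sub: "x \<in> S \<Longrightarrow> N x \<subseteq> S"
begin

definition space :: "'b topology" where
  "space = topology (\<lambda>U. U \<subseteq> S \<and> (\<forall>x\<in>U. N x \<subseteq> U))"

lemma openin_space: "openin space U \<longleftrightarrow> U \<subseteq> S \<and> (\<forall>x\<in>U. N x \<subseteq> U)"
proof -
  have "istopology (\<lambda>U. U \<subseteq> S \<and> (\<forall>x\<in>U. N x \<subseteq> U))"
    unfolding istopology_def by (intro conjI allI impI) blast+
  thus ?thesis by (simp add: space_def topology_inverse')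
qed

lemma topspace_space: "topspace space = S"
proof
  show "topspace space \<subseteq> S" using openin_space[THEN iffD1, OF openin_topspace] by blast
  have "openin space S" using N_sub by (simp add: openin_space)
  thus "S \<subseteq> topspace space" by (rule openin_subset)
qed

lemma interior_of_space: "space interior_of U = {x \<in> S. N x \<subseteq> U}"
proof -
  have "openin space (N x)" if "x \<in> S" for x
    using that N_trans N_sub by (simp add: openin_space)
  hence "x \<in> space interior_of U" if "x \<in> S" "N x \<subseteq> U" for x
    using that N_refl[of x] unfolding interior_of_def by blast
  moreover have "x \<in> S \<and> N x \<subseteq> U" if "x \<in> space interior_of U" for x
    using that unfolding interior_of_def openin_space by blast
  ultimately show ?thesis by blast
qed

lemma closure_of_space: "space closure_of U = {x \<in> S. N x \<inter> U \<noteq> {}}"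
proof -
  have "space closure_of U = S - space interior_of (S - U)"
    by (simp add: closure_of_interior_of topspace_space)
  thus ?thesis using N_sub by (auto simp: interior_of_space)
qed

end

lemma up_refl: "t \<in> set (up t)"
  by (cases t) auto

lemma up_trans: "s \<in> set (up t) \<Longrightarrow> set (up s) \<subseteq> set (up t)"
  by (cases t) (auto split: if_splits)

text \<open>
  These four equivalences compute interior, exterior, dust and the closure of the dust in the
  space whose points are kinds, from the smallest neighbourhoods alone.
\<close>

lemma up_in_set: "(\<forall>s\<in>set (up t). in_set s) \<longleftrightarrow> t = Inn"
  by (cases t) auto

lemma up_not_in_set: "(\<forall>s\<in>set (up t). \<not> in_set s) \<longleftrightarrow> t = Out"
  by (cases t) auto

lemma up_frontier: "(\<forall>s\<in>set (up t). s \<noteq> Inn \<and> s \<noteq> Out) \<longleftrightarrow> t \<in> range Dust"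
  by (cases t) auto

lemma near_dust_iff: "set (up t) \<inter> range Dust \<noteq> {} \<longleftrightarrow> near_dust t"
  by (cases t) auto

text \<open>
  Take one point for every kind in \<open>R\<close>, with the forced kinds as its smallest neighbourhood.
  Closedness of \<open>R\<close> keeps these neighbourhoods inside the space, and then every point has exactly
  the kind that it is named after. The points are named by an injection into an arbitrary type
  so that the space can be built on the natural numbers.
\<close>

lemma realisation:
  fixes R :: "kind set" and enc :: "kind \<Rightarrow> 'b"
  assumes enc: "inj enc" and up: "\<And>t. t \<in> R \<Longrightarrow> set (up t) \<subseteq> R"
  shows "\<exists>(X :: 'b topology) A. A \<subseteq> topspace X \<and> subset_in_space.kind_at X A ` topspace X = R"
proof -
  define S where "S = enc ` R"
  define N where "N x = enc ` set (up (inv enc x))" for x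
  have N: "N (enc t) = enc ` set (up t)" for t using enc by (simp add: N_def)
  interpret minimal_neighbourhoods S N
  proof
    fix x assume "x \<in> S"
    then obtain t where t: "x = enc t" "t \<in> R" by (auto simp: S_def)
    show "x \<in> N x" using up_refl[of t] by (simp add: t N)
    show "N x \<subseteq> S" using up[OF t(2)] by (auto simp: t N S_def)
    show "N y \<subseteq> N x" if "y \<in> N x" for y
      using that up_trans by (fastforce simp: t N)
  qed
  let ?A = "enc ` {t \<in> R. in_set t}"
  have "?A \<subseteq> S" by (auto simp: S_def)
  then interpret A: subset_in_space space ?A
    by unfold_locales (simp only: topspace_space)
  have mem: "enc t \<in> enc ` T \<longleftrightarrow> t \<in> T" for t T using enc by (rule inj_image_mem_iff)
  have up': "s \<in> R" if "s \<in> set (up t)" "t \<in> R" for s t using up[OF that(2)] that(1) by blast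
  have S_mem: "enc t \<in> S \<longleftrightarrow> t \<in> R" for t by (simp add: S_def mem)
  have int: "enc t \<in> space interior_of (enc ` T) \<longleftrightarrow> set (up t) \<subseteq> T" if "t \<in> R" for t T
    using that enc by (auto simp: interior_of_space S_mem N mem inj_image_subset_iff)
  have clo: "enc t \<in> space closure_of (enc ` T) \<longleftrightarrow> set (up t) \<inter> T \<noteq> {}" if "t \<in> R" for t T
    using that enc by (auto simp: closure_of_space S_mem N mem simp flip: image_Int)
  have image: "U = enc ` {t \<in> R. P t}" if "U \<subseteq> S" "\<And>t. t \<in> R \<Longrightarrow> enc t \<in> U \<longleftrightarrow> P t" for U P
    using that by (auto simp: S_def)
  have inn: "A.inn = enc ` {t \<in> R. t = Inn}"
    using interior_of_subset_topspace[of space] up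
    by (intro image) (auto simp: A.inn_def int topspace_space up_in_set[symmetric] dest: up')
  have "S - ?A = enc ` {t \<in> R. \<not> in_set t}"
    by (intro image) (auto simp: mem S_mem)
  hence out: "A.out = enc ` {t \<in> R. t = Out}"
    using interior_of_subset_topspace[of space] up
    by (intro image) (auto simp: A.out_def int topspace_space up_not_in_set[symmetric] dest: up')
  have "space frontier_of ?A = enc ` {t \<in> R. t \<noteq> Inn \<and> t \<noteq> Out}"
    by (intro image) (auto simp: A.frontier_eq inn out mem S_mem topspace_space)
  hence dust: "A.dust = enc ` {t \<in> R. t \<in> range Dust}"
    using interior_of_subset_topspace[of space] up
    by (intro image) (auto simp: A.dust_def int topspace_space up_frontier[symmetric] dest: up')
  have "A.kind_at (enc t) = t" if "t \<in> R" for t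
  proof -
    have near: "enc t \<in> space closure_of A.inn \<longleftrightarrow> near_inn t"
      "enc t \<in> space closure_of A.out \<longleftrightarrow> near_out t"
      "enc t \<in> space closure_of A.dust \<longleftrightarrow> near_dust t"
      using that up[OF that] near_dust_iff[of t] by (auto simp: inn out dust clo)
    show ?thesis
      unfolding A.kind_at_def near using that by (cases t) (auto simp: inn out mem)
  qed
  hence "A.kind_at ` topspace space = R"
    unfolding topspace_space by (force simp: S_def)
  thus ?thesis using A.A_sub by blast
qed

section \<open>Sixteen equations decide all others\<close>

text \<open>
  The first three equations say that there is no interior, no exterior, no dust; the next two that
  the subset is open, is closed; then follow the absence of slits and of whiskers. The remaining
  ones say which of the kinds on the frontiers of \<open>bi\<close>, \<open>ib\<close> and \<open>if\<close> are absent, alone or in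
  combination with slits and whiskers.
\<close>

definition basic_equations :: "(word \<times> word) list" where
  "basic_equations =
    [([Itr], [Zero]), ([Clo], [Compl, Zero]), ([Itr, Bd], [Zero]),
     ([], [Itr]), ([], [Clo]),
     ([Itr], [Itr, Clo, Itr]), ([Clo], [Clo, Itr, Clo]),
     ([Bd, Clo, Itr], [Zero]), ([Bd, Itr, Clo], [Zero]), ([Bd, Itr, Bd], [Zero]),
     ([Bd, Clo, Itr], [Bd, Itr, Clo]), ([Bd, Itr, Bd], [Bd, Itr, Clo]), ([Bd, Itr, Bd], [Bd, Clo, Itr]),
     ([Bd, Bd], [Bd, Clo]), ([Bd, Bd], [Bd, Itr]), ([Bd, Bd], [Bd, Itr, Bd])]"

text \<open>
  The equation fails at some point of every neighbourhood of a point of kind \<open>t\<close>. Looking at the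
  neighbourhood instead of the point alone makes far more equations comparable: a \<open>Slit\<close> point of
  the subset, for instance, also witnesses everything that a \<open>Slit\<close> point outside it does.
\<close>

definition separates :: "kind \<Rightarrow> word \<times> word \<Rightarrow> bool" where
  "separates t e = list_ex (\<lambda>s. region (fst e) s \<noteq> region (snd e) s) (up t)"

definition vec :: "(kind \<Rightarrow> bool) \<Rightarrow> bool list" where
  "vec f = map f kinds"

definition profile :: "word \<times> word \<Rightarrow> bool list" where
  "profile e = vec (\<lambda>t. separates t e)"

definition base_words :: "word list" where
  "base_words = map fst region_table"

definition basic_profiles :: "bool list list" where
  "basic_profiles = map profile basic_equations"

text \<open>
  If the profile \<open>c\<close> is a union of some profiles in \<open>bs\<close>, it is also the union of all those that
  lie below it, so no search for a representation is needed.
\<close>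

definition union_of_basics :: "bool list list \<Rightarrow> bool list \<Rightarrow> bool" where
  "union_of_basics bs c \<longleftrightarrow>
     foldr (map2 (\<or>)) (filter (\<lambda>b. list_all2 (\<longrightarrow>) b c) bs) (map (\<lambda>_. False) c) = c"

lemma kinds_UNIV: "set kinds = UNIV"
proof -
  have "t \<in> set kinds" for t
  proof (cases t)
    case (Slit j) thus ?thesis by (cases j) (auto simp: kinds_def)
  next
    case (Whisker j) thus ?thesis by (cases j) (auto simp: kinds_def)
  next
    case (Dust j) thus ?thesis by (cases j) (auto simp: kinds_def)
  next
    case (Wall j) thus ?thesis by (cases j) (auto simp: kinds_def)
  next
    case (Dust_Inn j) thus ?thesis by (cases j) (auto simp: kinds_def)
  next
    case (Dust_Out j) thus ?thesis by (cases j) (auto simp: kinds_def)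
  next
    case (Triple j) thus ?thesis by (cases j) (auto simp: kinds_def)
  qed (auto simp: kinds_def)
  thus ?thesis by blast
qed

lemma map2_map: "map2 h (map f xs) (map g xs) = map (\<lambda>x. h (f x) (g x)) xs"
  by (induction xs) auto

lemma vec_le: "list_all2 (\<longrightarrow>) (vec f) (vec g) \<longleftrightarrow> (\<forall>t. f t \<longrightarrow> g t)"
  by (simp add: vec_def list_all2_map1 list_all2_map2 list_all2_same kinds_UNIV)

lemma vec_eq: "vec f = vec g \<longleftrightarrow> f = g"
  by (auto simp: vec_def kinds_UNIV)

lemma foldr_vec: "foldr (map2 (\<or>)) (map vec fs) (vec (\<lambda>_. False)) = vec (\<lambda>t. \<exists>f\<in>set fs. f t)"
  by (induction fs) (auto simp: vec_def map2_map)

lemma union_of_basics_iff: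
  assumes "union_of_basics basic_profiles (profile e)"
  shows "separates t e \<longleftrightarrow>
    (\<exists>b\<in>set basic_equations. separates t b \<and> (\<forall>s. separates s b \<longrightarrow> separates s e))"
proof -
  let ?sep = "\<lambda>e t. separates t e"
  let ?bs = "filter (\<lambda>b. \<forall>s. separates s b \<longrightarrow> separates s e) basic_equations"
  have "filter (\<lambda>b. list_all2 (\<longrightarrow>) b (profile e)) basic_profiles = map vec (map ?sep ?bs)"
    by (simp add: basic_profiles_def profile_def filter_map comp_def vec_le)
  moreover have "map (\<lambda>_. False) (profile e) = vec (\<lambda>_. False)"
    by (simp add: profile_def vec_def)
  ultimately have "vec (\<lambda>t. \<exists>f\<in>set (map ?sep ?bs). f t) = vec (?sep e)"
    using assms by (simp only: union_of_basics_def foldr_vec) (simp add: profile_def)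
  hence "(\<lambda>t. \<exists>f\<in>set (map ?sep ?bs). f t) = ?sep e" by (simp only: vec_eq)
  from fun_cong[OF this, of t] show ?thesis by auto
qed

text \<open>
  Complementing both sides of an equation does not change its meaning, so it suffices to let the
  left-hand side range over the words without a leading complement.
\<close>

definition equations :: "(word \<times> word) list" where
  "equations = [(u, w). u \<leftarrow> base_words, v \<leftarrow> base_words, w \<leftarrow> [v, Compl # v]]"

text \<open>
  The recursion runs over the list of equations, with the basic profiles passed as an argument, so that
  symbolic evaluation computes them only once.
\<close>

fun unions_of_basics :: "bool list list \<Rightarrow> (word \<times> word) list \<Rightarrow> bool" where
  "unions_of_basics bs [] = True"
| "unions_of_basics bs (e # es) = (union_of_basics bs (profile e) \<and> unions_of_basics bs es)"

lemma unions_of_basics_iff: "unions_of_basics bs es \<longleftrightarrow> (\<forall>e\<in>set es. union_of_basics bs (profile e))"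
  by (induction es) auto

lemma unions_of_basics_equations: "unions_of_basics basic_profiles equations"
  by code_simp

text \<open>
  Every equation between two words is, as far as its failures are concerned, the conjunction of
  the basic equations that it implies.
\<close>

lemma separates_basic:
  assumes "u \<in> KF" "v \<in> KF"
  shows "separates t (u, v) \<longleftrightarrow>
    (\<exists>b\<in>set basic_equations. separates t b \<and> (\<forall>s. separates s b \<longrightarrow> separates s (u, v)))"
proof -
  have compl: "separates s (Compl # u, w) \<longleftrightarrow> separates s (u, Compl # w)"
    "separates s (Compl # u, Compl # w) \<longleftrightarrow> separates s (u, w)" for s u w
    by (simp_all add: separates_def list_ex_iff)
  obtain u' v' where "u' \<in> KF0" "v' \<in> KF0" and uv: "u = u' \<or> u = Compl # u'" "v = v' \<or> v = Compl # v'"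
    using assms unfolding KF_def by blast
  hence mem: "(u', v') \<in> set equations" "(u', Compl # v') \<in> set equations"
    by (auto simp: equations_def base_words_def KF0_eq)
  have "\<exists>e\<in>set equations. \<forall>s. separates s (u, v) \<longleftrightarrow> separates s e"
    using uv
  proof (elim disjE)
    assume "u = u'" "v = v'"
    thus ?thesis using mem(1) by blast
  next
    assume "u = u'" "v = Compl # v'"
    thus ?thesis using mem(2) by blast
  next
    assume "u = Compl # u'" "v = v'"
    thus ?thesis using mem(2) compl(1) by blast
  next
    assume "u = Compl # u'" "v = Compl # v'"
    thus ?thesis using mem(1) compl(2) by blast
  qed
  then obtain e where e: "e \<in> set equations" "\<And>s. separates s (u, v) \<longleftrightarrow> separates s e"
    by blast
  have "union_of_basics basic_profiles (profile e)"
    using unions_of_basics_equations e(1) by (simp add: unions_of_basics_iff)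
  thus ?thesis using union_of_basics_iff[of e t] by (simp add: e(2))
qed

definition agree :: "kind set \<Rightarrow> word \<times> word \<Rightarrow> bool" where
  "agree R e \<longleftrightarrow> (\<forall>t\<in>R. region (fst e) t = region (snd e) t)"

definition up_closed :: "kind set \<Rightarrow> bool" where
  "up_closed R \<longleftrightarrow> (\<forall>t\<in>R. set (up t) \<subseteq> R)"

text \<open>
  The basic equations that fail, as a bit string. An equation fails on a union as soon as it fails
  on one of the parts, so the signature of a union is the bitwise disjunction of the signatures.
\<close>

definition signature :: "kind set \<Rightarrow> bool list" where
  "signature R = map (\<lambda>e. \<exists>t\<in>R. separates t e) basic_equations"

definition collapse_of :: "kind set \<Rightarrow> word set set" where
  "collapse_of R = {{u, v} | u v. u \<in> KF \<and> v \<in> KF \<and> u \<noteq> v \<and> agree R (u, v)}"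

lemma mem_collapse_of:
  "{u, v} \<in> collapse_of R \<longleftrightarrow> u \<in> KF \<and> v \<in> KF \<and> u \<noteq> v \<and> agree R (u, v)"
  by (auto simp: collapse_of_def doubleton_eq_iff agree_def)

lemma agree_separates: "up_closed R \<Longrightarrow> agree R e \<longleftrightarrow> \<not> (\<exists>t\<in>R. separates t e)"
  using up_refl by (fastforce simp: agree_def separates_def list_ex_iff up_closed_def)

lemma basic_equations_KF: "(u, v) \<in> set basic_equations \<Longrightarrow> u \<in> KF \<and> v \<in> KF \<and> u \<noteq> v"
  by (auto simp: basic_equations_def KF_def KF0_def K0_def F0_def)

text \<open>
  From left to right the basic equations can be read off the collapse, since they are equations
  between distinct words. From right to left every equation is a conjunction of basic ones.
\<close>

lemma collapse_of_eq_iff: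
  assumes "up_closed R" "up_closed R'"
  shows "collapse_of R = collapse_of R' \<longleftrightarrow> signature R = signature R'"
proof
  assume eq: "collapse_of R = collapse_of R'"
  have "agree R e \<longleftrightarrow> agree R' e" if "e \<in> set basic_equations" for e
    using that basic_equations_KF[of "fst e" "snd e"] mem_collapse_of[of "fst e" "snd e" R]
      mem_collapse_of[of "fst e" "snd e" R'] eq by simp
  thus "signature R = signature R'"
    unfolding agree_separates[OF assms(1)] agree_separates[OF assms(2)] signature_def
    by (intro map_cong) blast+
next
  assume "signature R = signature R'"
  hence sig: "(\<exists>t\<in>R. separates t b) \<longleftrightarrow> (\<exists>t\<in>R'. separates t b)" if "b \<in> set basic_equations" for b
    using that by (simp add: signature_def)
  have "agree R (u, v) \<longleftrightarrow> agree R' (u, v)" if "u \<in> KF" "v \<in> KF" for u v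
    unfolding agree_separates[OF assms(1)] agree_separates[OF assms(2)]
    using separates_basic[OF that] sig by blast
  thus "collapse_of R = collapse_of R'"
    unfolding collapse_of_def by blast
qed

section \<open>Counting the signatures\<close>

text \<open>
  Sets of bit strings are kept as tries, the Boolean at a node telling whether the string read so
  far belongs to the set. Disjunction of all members with a fixed string then removes duplicates by itself,
  without comparing strings, and the terms stay small enough to be evaluated by rewriting.
\<close>

datatype trie = Empty | Node bool trie trie

fun count :: "trie \<Rightarrow> nat" where
  "count Empty = 0"
| "count (Node e l r) = (if e then Suc (count l + count r) else count l + count r)"

fun merge :: "trie \<Rightarrow> trie \<Rightarrow> trie" where
  "merge Empty t = t"
| "merge t Empty = t"
| "merge (Node e l r) (Node e' l' r') = Node (e \<or> e') (merge l l') (merge r r')"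

text \<open>
  Bitwise disjunction with \<open>g\<close>, performed on all members at once: where \<open>g\<close> has a one, both
  branches end up in the right one.
\<close>

fun raise :: "bool list \<Rightarrow> trie \<Rightarrow> trie" where
  "raise [] t = t"
| "raise g Empty = Empty"
| "raise (b # g) (Node e l r) =
     (if b then Node e Empty (merge (raise g l) (raise g r)) else Node e (raise g l) (raise g r))"

fun single :: "bool list \<Rightarrow> trie" where
  "single [] = Node True Empty Empty"
| "single (b # bs) = (if b then Node False Empty (single bs) else Node False (single bs) Empty)"

definition signature_of_kind :: "kind \<Rightarrow> bool list" where
  "signature_of_kind t = map (separates t) basic_equations"

definition extend :: "bool list \<Rightarrow> trie \<Rightarrow> trie" where
  "extend g T = merge T (raise g T)"

text \<open>
  Adding the kinds one at a time, each new kind either being taken or not, generates the signatures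
  of all sets of kinds.
\<close>

fun signatures :: "kind list \<Rightarrow> trie" where
  "signatures [] = single (map (\<lambda>_. False) basic_equations)"
| "signatures (t # ts) = extend (signature_of_kind t) (signatures ts)"

fun strings :: "trie \<Rightarrow> bool list set" where
  "strings Empty = {}"
| "strings (Node e l r) = (if e then {[]} else {}) \<union> Cons False ` strings l \<union> Cons True ` strings r"

fun bitwise_or :: "bool list \<Rightarrow> bool list \<Rightarrow> bool list" where
  "bitwise_or [] s = s"
| "bitwise_or g [] = []"
| "bitwise_or (a # g) (b # s) = (a \<or> b) # bitwise_or g s"

lemma finite_strings: "finite (strings T)"
  by (induction T) auto

lemma card_strings: "card (strings T) = count T"
proof (induction T)
  case (Node e l r)
  let ?l = "Cons False ` strings l" and ?r = "Cons True ` strings r"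
  have "card (?l \<union> ?r) = count l + count r"
    using Node finite_strings by (subst card_Un_disjoint) (auto simp: card_image)
  moreover have "card (strings (Node e l r)) = (if e then Suc (card (?l \<union> ?r)) else card (?l \<union> ?r))"
    using finite_strings by (auto simp: card_insert_if)
  ultimately show ?case by simp
qed simp

lemma strings_merge: "strings (merge S T) = strings S \<union> strings T"
  by (induction S T rule: merge.induct) auto

lemma strings_raise: "strings (raise g T) = bitwise_or g ` strings T"
  by (induction g T rule: raise.induct) (auto simp: strings_merge image_Un image_image)

lemma strings_single: "strings (single bs) = {bs}"
  by (induction bs) auto

lemma bitwise_or_map: "bitwise_or (map f xs) (map g xs) = map (\<lambda>x. f x \<or> g x) xs"
  by (induction xs) auto

lemma strings_signatures: "strings (signatures ts) = signature ` Pow (set ts)"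
proof (induction ts)
  case Nil
  show ?case by (simp add: strings_single signature_def)
next
  case (Cons t ts)
  have "bitwise_or (signature_of_kind t) (signature T) = signature (insert t T)" for T
    by (simp add: signature_of_kind_def signature_def bitwise_or_map)
  thus ?case
    by (simp add: Cons extend_def strings_merge strings_raise Pow_insert image_Un image_image)
qed

text \<open>
  One of these 71 signatures belongs to the empty set of kinds, that is, to the empty space.
\<close>

lemma count_signatures: "count (signatures kinds) = 71"
  by code_simp

lemma kind_separated: "\<exists>e\<in>set basic_equations. separates t e"
proof -
  have "list_all (\<lambda>t. list_ex (separates t) basic_equations) kinds"
    by code_simp
  thus ?thesis by (simp add: list_all_iff list_ex_iff kinds_UNIV)
qed

text \<open>
  Closing a set of kinds upwards makes no further basic equation fail, so all nonempty sets of kinds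
  may be counted instead of the up-closed ones.
\<close>

lemma signature_up_closure: "signature (\<Union>t\<in>T. set (up t)) = signature T"
proof -
  have "(\<exists>s\<in>set (up t). separates s e) \<longleftrightarrow> separates t e" for t e
    using up_refl up_trans by (fastforce simp: separates_def list_ex_iff)
  thus ?thesis by (auto simp: signature_def)
qed

lemma card_image_same_kernel:
  assumes "\<And>x y. x \<in> A \<Longrightarrow> y \<in> A \<Longrightarrow> f x = f y \<longleftrightarrow> g x = g y"
  shows "card (f ` A) = card (g ` A)"
proof -
  define h where "h z = g (inv_into A f z)" for z
  have "h (f x) = g x" if "x \<in> A" for x
    unfolding h_def using assms that f_inv_into_f[of "f x" f A] inv_into_into[of "f x" f A] by blast
  hence "bij_betw h (f ` A) (g ` A)"
    using assms by (intro bij_betw_imageI) (auto simp: inj_on_def image_image)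
  thus ?thesis by (rule bij_betw_same_card)
qed

lemma card_collapses: "card (collapse_of ` {R. up_closed R \<and> R \<noteq> {}}) = 70"
proof -
  let ?U = "{R. up_closed R \<and> R \<noteq> {}}"
  have nonempty: "signature T \<noteq> signature {}" if "T \<noteq> {}" for T
    using that kind_separated by (fastforce simp: signature_def)
  have "signature ` ?U = strings (signatures kinds) - {signature {}}"
  proof
    show "signature ` ?U \<subseteq> strings (signatures kinds) - {signature {}}"
      using nonempty by (auto simp: strings_signatures kinds_UNIV)
    show "strings (signatures kinds) - {signature {}} \<subseteq> signature ` ?U"
    proof
      fix s assume "s \<in> strings (signatures kinds) - {signature {}}"
      then obtain T where T: "s = signature T" "T \<noteq> {}"
        by (auto simp: strings_signatures)
      have "(\<Union>t\<in>T. set (up t)) \<in> ?U"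
        using T(2) up_refl up_trans by (fastforce simp: up_closed_def)
      thus "s \<in> signature ` ?U" using T(1) signature_up_closure by (metis imageI)
    qed
  qed
  hence "card (signature ` ?U) = 70"
    using finite_strings card_strings[of "signatures kinds"]
    by (simp add: count_signatures strings_signatures)
  moreover have "card (collapse_of ` ?U) = card (signature ` ?U)"
    by (rule card_image_same_kernel) (simp add: collapse_of_eq_iff)
  ultimately show ?thesis by simp
qed

section \<open>Local collapses\<close>

text \<open>
  Two words agree on the subset exactly when their regions agree on the kinds that occur. The
  collapse satisfied by a subset therefore depends on the set of these kinds only.
\<close>

lemma satisfies_iff:
  assumes "A \<subseteq> topspace X" and "collapse C"
  shows "satisfies X A C \<longleftrightarrow> C = collapse_of (subset_in_space.kind_at X A ` topspace X)"
proof -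
  interpret subset_in_space X A by standard (fact assms(1))
  let ?R = "kind_at ` topspace X"
  have eq: "word_op X u A = word_op X v A \<longleftrightarrow> agree ?R (u, v)" if "u \<in> KF" "v \<in> KF" for u v
    using that by (auto simp: word_op_kind_at agree_def)
  have "satisfies X A C \<longleftrightarrow> (\<forall>u v. u \<in> KF \<longrightarrow> v \<in> KF \<longrightarrow> u \<noteq> v \<longrightarrow> ({u, v} \<in> C \<longleftrightarrow> {u, v} \<in> collapse_of ?R))"
    unfolding satisfies_def mem_collapse_of using eq by blast
  also have "\<dots> \<longleftrightarrow> C = collapse_of ?R"
  proof
    assume *: "\<forall>u v. u \<in> KF \<longrightarrow> v \<in> KF \<longrightarrow> u \<noteq> v \<longrightarrow> ({u, v} \<in> C \<longleftrightarrow> {u, v} \<in> collapse_of ?R)"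
    have "P \<in> C \<longleftrightarrow> P \<in> collapse_of ?R" for P
    proof (cases "\<exists>u v. P = {u, v} \<and> u \<in> KF \<and> v \<in> KF \<and> u \<noteq> v")
      case True
      thus ?thesis using * by blast
    next
      case False
      thus ?thesis using assms(2) unfolding collapse_def collapse_of_def by blast
    qed
    thus "C = collapse_of ?R" by blast
  qed blast
  finally show ?thesis .
qed

lemma collapse_collapse_of: "collapse (collapse_of R)"
  unfolding collapse_def collapse_of_def by blast

lemma local_collapses_subset:
  "local_collapses TYPE('a) \<subseteq> collapse_of ` {R. up_closed R \<and> R \<noteq> {}}"
proof
  fix C assume "C \<in> local_collapses TYPE('a)"
  then obtain X :: "'a topology" and A where X: "topspace X \<noteq> {}" "A \<subseteq> topspace X"
    and C: "C = collapse_of (subset_in_space.kind_at X A ` topspace X)"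
    by (auto simp: local_collapses_def satisfies_iff)
  interpret subset_in_space X A by standard (fact X(2))
  have "up_closed (kind_at ` topspace X)" using up_closed_kinds by (simp add: up_closed_def)
  with X(1) C show "C \<in> collapse_of ` {R. up_closed R \<and> R \<noteq> {}}" by blast
qed

lemma local_collapses_nat:
  "local_collapses TYPE(nat) = collapse_of ` {R. up_closed R \<and> R \<noteq> {}}"
proof (rule equalityI[OF local_collapses_subset], rule subsetI)
  fix C assume "C \<in> collapse_of ` {R. up_closed R \<and> R \<noteq> {}}"
  then obtain R where R: "up_closed R" "R \<noteq> {}" "C = collapse_of R" by blast
  have "finite (UNIV :: kind set)" by (metis kinds_UNIV finite_set)
  then obtain enc :: "kind \<Rightarrow> nat" where "inj enc"
    using finite_imp_inj_to_nat_seg by metis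
  then obtain X :: "nat topology" and A where
    "A \<subseteq> topspace X" "subset_in_space.kind_at X A ` topspace X = R"
    using realisation[of enc R] R(1) by (auto simp: up_closed_def)
  moreover from this have "topspace X \<noteq> {}" using R(2) by auto
  ultimately show "C \<in> local_collapses TYPE(nat)"
    unfolding local_collapses_def using satisfies_iff[OF _ collapse_collapse_of] R(3) collapse_collapse_of
    by blast
qed

theorem theorem7:
  shows "local_collapses TYPE('a) \<subseteq> local_collapses TYPE(nat)
    \<and> card (local_collapses TYPE(nat)) = 70"
  by (simp add: local_collapses_subset local_collapses_nat card_collapses)

end
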